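(* Let $\mathbf{P}$ be a permuton, let $(X,Y)$ be a random vector with law $\mathbf{P}$, and let $(X',Y')$ be an independent copy of $(X,Y)$. Then the Wasserstein distance of the identity permuton $\mathbf{id}$ from $\mathbf{P}$ is given by $$W(\mathbf{id},\mathbf{P})^2=\frac43-2\,\mathbb{E}\left[\max\{X+Y,\,X'+Y'\}\right].$$
   Context: A permuton is a Borel probability measure on $[-1,1]^2$ both of whose marginals are uniform on $[-1,1]$. The identity permuton $\mathbf{id}$ is the law of $(U,U)$ with $U$ uniform on $[-1,1]$. $W$ is the 2-Wasserstein distance for the Euclidean metric on $[-1,1]^2$: $W(\mu,\nu)^2=\inf\mathbb{E}[\|V-V'\|^2]$ over couplings $(V,V')$ with $V\sim\mu$, $V'\sim\nu$. *)

theory Defs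
  imports "HOL-Probability.Probability"
begin

definition uniform_pm1 :: "real measure" where
  "uniform_pm1 = uniform_measure lborel {-1..1}"

text \<open>Measures on the square are represented as Borel measures on the plane that give the
  square full mass.\<close>

definition permuton :: "(real \<times> real) measure \<Rightarrow> bool" where
  "permuton P \<longleftrightarrow>
     prob_space P \<and> sets P = sets borel \<and>
     emeasure P ({-1..1} \<times> {-1..1}) = 1 \<and>
     distr P borel fst = uniform_pm1 \<and>
     distr P borel snd = uniform_pm1"

definition id_permuton :: "(real \<times> real) measure" where
  "id_permuton = distr uniform_pm1 borel (\<lambda>u. (u, u))"

definition couplings ::
  "(real \<times> real) measure \<Rightarrow> (real \<times> real) measure \<Rightarrow> ((real \<times> real) \<times> (real \<times> real)) measure set"
where
  "couplings \<mu> \<nu> =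
     {\<pi>. prob_space \<pi> \<and> sets \<pi> = sets borel \<and> distr \<pi> borel fst = \<mu> \<and> distr \<pi> borel snd = \<nu>}"

text \<open>The norm on \<open>real \<times> real\<close> is the Euclidean one. The infimum is taken in \<open>ennreal\<close>, so that
  no integrability condition on the couplings is needed; it is finite whenever both
  measures are concentrated on a bounded set, as is the case for permutons.\<close>

definition wasserstein2 :: "(real \<times> real) measure \<Rightarrow> (real \<times> real) measure \<Rightarrow> real" where
  "wasserstein2 \<mu> \<nu> =
     sqrt (enn2real (INF \<pi>\<in>couplings \<mu> \<nu>. \<integral>\<^sup>+ z. ennreal ((norm (fst z - snd z))\<^sup>2) \<partial>\<pi>))"

lemma permuton_id_permuton: "permuton id_permuton"
proof -
  have sets: "sets uniform_pm1 = sets borel"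
    by (simp add: uniform_pm1_def)
  interpret U: prob_space uniform_pm1
    unfolding uniform_pm1_def by (rule prob_space_uniform_measure) auto
  have meas [measurable]: "(\<lambda>u. (u, u)) \<in> borel_measurable uniform_pm1"
    by (simp add: measurable_cong_sets[OF sets refl])
  have "closed ({-1..1::real} \<times> {-1..1::real})"
    by (intro closed_Times closed_atLeastAtMost)
  then have "emeasure id_permuton ({-1..1} \<times> {-1..1}) =
      emeasure uniform_pm1 ((\<lambda>u. (u, u)) -` ({-1..1} \<times> {-1..1}) \<inter> space uniform_pm1)"
    unfolding id_permuton_def by (intro emeasure_distr meas borel_closed)
  also have "(\<lambda>u. (u, u)) -` ({-1..1} \<times> {-1..1}) \<inter> space uniform_pm1 = {-1..1::real}"
    using sets_eq_imp_space_eq[OF sets] by auto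
  also have "emeasure uniform_pm1 {-1..1} = 1"
    unfolding uniform_pm1_def by (simp add: ennreal_divide_self)
  finally have "emeasure id_permuton ({-1..1} \<times> {-1..1}) = 1" .
  moreover have "distr id_permuton borel fst = uniform_pm1"
    and "distr id_permuton borel snd = uniform_pm1"
    unfolding id_permuton_def
    by (simp_all add: distr_distr borel_measurable_continuous_onI continuous_on_fst
        continuous_on_snd comp_def distr_id2 sets)
  moreover have "prob_space id_permuton"
    unfolding id_permuton_def by (rule U.prob_space_distr) (rule meas)
  ultimately show ?thesis
    by (simp add: permuton_def id_permuton_def)
qed

end

theory Submission
  imports Defs
begin

text \<open>Put \<open>S = X + Y\<close>. A coupling with the identity permuton costs \<open>4/3 - 2 E[U S]\<close>, where \<open>U\<close> is the
  common coordinate of the diagonal point. Writing \<open>(U + 1) / 2\<close> as the probability that an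
  independent copy \<open>U'\<close> is below \<open>U\<close> gives
  \<open>E[U S] = E[1(U' < U) S + 1(U < U') S']\<close> since \<open>E[S] = 0\<close>, and this is at most \<open>E[max(S, S')]\<close>.
  Equality is approached when \<open>U\<close> is the rank of a slightly smoothed \<open>S\<close>.\<close>

subsection \<open>The uniform distribution\<close>

lemma prob_space_uniform_pm1: "prob_space uniform_pm1"
  unfolding uniform_pm1_def by (rule prob_space_uniform_measure) auto

lemma sets_uniform_pm1 [simp, measurable_cong]: "sets uniform_pm1 = sets borel"
  by (simp add: uniform_pm1_def)

lemma AE_uniform_pm1: "AE u in uniform_pm1. \<bar>u\<bar> \<le> 1"
  unfolding uniform_pm1_def by (rule AE_uniform_measureI) (auto simp: abs_le_iff)

lemma measure_uniform_pm1_lessThan: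
  assumes "\<bar>u\<bar> \<le> 1"
  shows "measure uniform_pm1 {..<u} = (u + 1) / 2"
proof -
  have "{-1..1} \<inter> {..<u} = {-1..<u}"
    using assms by auto
  then show ?thesis
    using assms unfolding uniform_pm1_def by (subst measure_uniform_measure) auto
qed

lemma measure_uniform_pm1_singleton: "measure uniform_pm1 {x} = 0"
proof -
  have "emeasure lborel ({-1..1} \<inter> {x}) = 0"
    by (cases "x \<in> {-1..1}") auto
  then show ?thesis
    unfolding uniform_pm1_def by (subst measure_uniform_measure) (auto simp: measure_def)
qed

lemma uniform_pm1_eq_density:
  "uniform_pm1 = density lborel (\<lambda>u. ennreal (indicator {-1..1} u / 2))"
proof -
  have "indicator {-1..1} u / 2 = ennreal (indicator {-1..1} u / 2)" for u :: real
    using divide_ennreal[of 1 2] by (simp add: indicator_def)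
  then show ?thesis
    by (simp add: uniform_pm1_def uniform_measure_def)
qed

lemma integral_power_uniform_pm1:
  "(\<integral>u. u ^ k \<partial>uniform_pm1) = (1 - (-1) ^ Suc k) / (2 * Suc k)"
proof -
  have "(\<integral>u. u ^ k \<partial>uniform_pm1) = (\<integral>u. (u ^ k * indicator {-1..1} u) / 2 \<partial>lborel)"
    unfolding uniform_pm1_eq_density
    by (subst integral_density) (auto intro!: Bochner_Integration.integral_cong)
  also have "\<dots> = (\<integral>u. u ^ k * indicator {-1..1} u \<partial>lborel) / 2"
    by simp
  also have "\<dots> = (1 - (-1) ^ Suc k) / (2 * Suc k)"
    by (subst integral_power) auto
  finally show ?thesis .
qed

text \<open>These are the facts about a coordinate that the cost needs: boundedness gives
  integrability, the mean 0 removes the term \<open>E[S]\<close>, and the second moment 1/3 produces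
  the constant 4/3.\<close>

lemma uniform_pm1_rv:
  assumes "prob_space N" and [measurable]: "V \<in> borel_measurable N"
    and V: "distr N borel V = uniform_pm1"
  shows "AE w in N. \<bar>V w\<bar> \<le> 1" and "(\<integral>w. V w \<partial>N) = 0" and "(\<integral>w. (V w)\<^sup>2 \<partial>N) = 1 / 3"
proof -
  show "AE w in N. \<bar>V w\<bar> \<le> 1"
    using AE_uniform_pm1 by (intro AE_distrD[of V N borel "\<lambda>u. \<bar>u\<bar> \<le> 1"]) (simp_all only: V assms)
  have "(\<integral>w. V w ^ k \<partial>N) = (\<integral>u. u ^ k \<partial>uniform_pm1)" for k
    unfolding V[symmetric] by (subst integral_distr) auto
  from this[of 1] this[of 2] show "(\<integral>w. V w \<partial>N) = 0" "(\<integral>w. (V w)\<^sup>2 \<partial>N) = 1 / 3"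
    using integral_power_uniform_pm1[of 1] integral_power_uniform_pm1[of 2] by simp_all
qed

lemma uniform_pm1_distrI:
  assumes "prob_space N" and U [measurable]: "U \<in> borel_measurable N"
    and U_le: "\<And>t. -1 \<le> t \<Longrightarrow> t \<le> 1 \<Longrightarrow> measure N {x \<in> space N. U x \<le> t} = (t + 1) / 2"
  shows "distr N borel U = uniform_pm1"
proof -
  interpret prob_space N by fact
  have "distributed N lborel U (\<lambda>x. indicator {-1..1} x / measure lborel {-1..1::real})"
    by (rule uniform_distrI_borel_atLeastAtMost) (auto simp: U_le)
  then have "distr N lborel U = density lborel (\<lambda>x. ennreal (indicator {-1..1} x / 2))"
    by (simp add: distributed_def)
  also have "\<dots> = uniform_pm1"
    by (simp add: uniform_pm1_eq_density)
  finally show ?thesis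
    by (simp add: distr_cong[OF refl sets_lborel refl])
qed

text \<open>This is the probability integral transform, rescaled from [0,1] to [-1,1]. A continuous
  distribution function takes every value strictly between 0 and 1, so the level sets of the rank
  can be compared with half-lines of \<open>R\<close>. It may have flat pieces, so the comparison
  uses monotonicity and no inverse.\<close>

lemma distr_cdf_uniform:
  assumes "prob_space N" and R [measurable]: "R \<in> borel_measurable N"
    and cont: "\<And>x. isCont (cdf (distr N borel R)) x"
  shows "distr N borel (\<lambda>w. 2 * cdf (distr N borel R) (R w) - 1) = uniform_pm1"
proof -
  interpret prob_space N by fact
  interpret L: real_distribution "distr N borel R" by simp
  define G where "G = cdf (distr N borel R)"
  have mono: "G x \<le> G y" if "x \<le> y" for x y
    unfolding G_def using that by (rule L.cdf_nondecreasing)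
  have G_borel [measurable]: "G \<in> borel_measurable borel"
    using mono by (intro borel_measurable_mono monoI)
  have G_eq: "G x = prob {w \<in> space N. R w \<le> x}" for x
    unfolding G_def cdf_def2 by (subst measure_distr) (auto intro!: arg_cong[where f = prob])
  have ex: "\<exists>x. G x = v" if v: "0 < v" "v < 1" for v
  proof -
    have "\<forall>\<^sub>F x in at_bot. G x < v" "\<forall>\<^sub>F x in at_top. v < G x"
      using L.cdf_lim_at_bot L.cdf_lim_at_top_prob v unfolding G_def
      by (auto intro: order_tendstoD)
    then obtain a b where ab: "\<And>x. x \<le> a \<Longrightarrow> G x < v" "\<And>x. b \<le> x \<Longrightarrow> v < G x"
      unfolding eventually_at_bot_linorder eventually_at_top_linorder by blast
    \<comment> \<open>Taking \<open>min a b\<close> as the left end keeps the interval ordered even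
      if \<open>b < a\<close>.\<close>
    have "G (min a b) \<le> v" "v \<le> G b"
      using ab by (auto intro: less_imp_le)
    moreover have "\<forall>x. min a b \<le> x \<and> x \<le> b \<longrightarrow> isCont G x"
      using cont unfolding G_def by blast
    ultimately show ?thesis
      using IVT[of G "min a b" v b] by auto
  qed
  have le_v: "prob {w \<in> space N. G (R w) \<le> v} = v" if v: "0 \<le> v" "v \<le> 1" for v
  proof (rule antisym)
    show "prob {w \<in> space N. G (R w) \<le> v} \<le> v"
    proof (cases "v = 1")
      case False
      \<comment> \<open>If \<open>G\<close> is flat at height \<open>v\<close>, then
        \<open>G (R w) \<le> v\<close> does not bound \<open>R w\<close> by a given point with value
        \<open>v\<close>. At a point \<open>x\<close> of slightly larger value \<open>v'\<close> it
        does force \<open>R w \<le> x\<close>; then \<open>v'\<close> decreases to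
        \<open>v\<close>.\<close>
      show ?thesis
      proof (rule dense_ge_bounded[of v 1])
        show "v < 1" using False v by simp
        fix v' assume v': "v < v'" "v' < 1"
        then obtain x where x: "G x = v'" using ex[of v'] v by auto
        have "prob {w \<in> space N. G (R w) \<le> v} \<le> prob {w \<in> space N. R w \<le> x}"
          using v' x mono by (intro finite_measure_mono) (auto, smt (verit))
        then show "prob {w \<in> space N. G (R w) \<le> v} \<le> v'"
          using x G_eq by simp
      qed
    qed simp
    show "v \<le> prob {w \<in> space N. G (R w) \<le> v}"
    proof -
      \<comment> \<open>The values 0 and 1 may be limits of \<open>G\<close> that are never
        attained, so they are treated apart.\<close>
      consider "v = 0" | "v = 1" | "0 < v" "v < 1" using v by linarith
      then show ?thesis
      proof cases
        case 2
        then have "{w \<in> space N. G (R w) \<le> v} = space N"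
          using L.cdf_bounded_prob by (auto simp: G_def)
        then show ?thesis using 2 prob_space by simp
      next
        case 3
        then obtain x where x: "G x = v" using ex by auto
        have "prob {w \<in> space N. R w \<le> x} \<le> prob {w \<in> space N. G (R w) \<le> v}"
          using x mono by (intro finite_measure_mono) auto
        then show ?thesis using x G_eq by simp
      qed simp
    qed
  qed
  have "distr N borel (\<lambda>w. 2 * G (R w) - 1) = uniform_pm1"
  proof (rule uniform_pm1_distrI)
    fix t :: real assume t: "-1 \<le> t" "t \<le> 1"
    have "{w \<in> space N. 2 * G (R w) - 1 \<le> t} = {w \<in> space N. G (R w) \<le> (t + 1) / 2}"
      by (auto simp: field_simps)
    then show "prob {w \<in> space N. 2 * G (R w) - 1 \<le> t} = (t + 1) / 2"
      using le_v[of "(t + 1) / 2"] t by simp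
  qed (auto intro: prob_space_axioms)
  then show ?thesis by (simp add: G_def)
qed

subsection \<open>Ranks and independent copies\<close>

text \<open>For fixed \<open>w\<close> the event \<open>U w' < U w\<close> has probability
  \<open>(U w + 1) / 2\<close>, so the first summand integrates to half of
  \<open>E[U S] + E[S]\<close>. Exchanging the two copies gives the same value for the second
  summand.\<close>

lemma integral_uniform_times:
  assumes "prob_space N" and [measurable]: "U \<in> borel_measurable N" "S \<in> borel_measurable N"
    and U: "distr N borel U = uniform_pm1" and S: "AE w in N. \<bar>S w\<bar> \<le> B"
  shows "(\<integral>w. U w * S w \<partial>N) + (\<integral>w. S w \<partial>N) =
    (\<integral>(w, w'). of_bool (U w' < U w) * S w + of_bool (U w < U w') * S w' \<partial>(N \<Otimes>\<^sub>M N))"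
    (is "_ = (\<integral>(w, w'). ?D w w' + ?D w' w \<partial>_)")
    and "integrable (N \<Otimes>\<^sub>M N)
      (\<lambda>(w, w'). of_bool (U w' < U w) * S w + of_bool (U w < U w') * S w')"
proof -
  interpret prob_space N by fact
  interpret NN: pair_prob_space N N ..
  have U_bd: "AE w in N. \<bar>U w\<bar> \<le> 1"
    by (rule uniform_pm1_rv(1)) (simp_all add: assms)
  have int_S: "integrable N S"
    using S by (intro integrable_const_bound[of _ B]) auto
  have int_US: "integrable N (\<lambda>w. U w * S w)"
  proof (rule integrable_const_bound[of _ "1 * B"])
    show "AE w in N. norm (U w * S w) \<le> 1 * B"
      using U_bd S by eventually_elim (auto simp only: real_norm_def abs_mult intro!: mult_mono)
  qed simp
  have AE1: "AE z in N \<Otimes>\<^sub>M N. \<bar>S (fst z)\<bar> \<le> B"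
    using S by (intro NN.AE_pair_measure) auto
  have int_D: "integrable (N \<Otimes>\<^sub>M N) (\<lambda>(w, w'). ?D w w')"
    by (rule NN.integrable_const_bound[of _ B]) (use AE1 in \<open>auto elim!: eventually_mono\<close>)
  then have int_D': "integrable (N \<Otimes>\<^sub>M N) (\<lambda>(w, w'). ?D w' w)"
    using NN.integrable_product_swap[OF int_D] by simp
  have prob_less: "prob {w' \<in> space N. U w' < u} = (u + 1) / 2" if "\<bar>u\<bar> \<le> 1" for u
  proof -
    have "prob {w' \<in> space N. U w' < u} = measure (distr N borel U) {..<u}"
      by (subst measure_distr) (auto intro!: arg_cong[where f = prob])
    then show ?thesis
      using measure_uniform_pm1_lessThan[OF that] by (simp add: U)
  qed
  have "(\<integral>(w, w'). ?D w w' \<partial>(N \<Otimes>\<^sub>M N)) = (\<integral>w. (\<integral>w'. ?D w w' \<partial>N) \<partial>N)"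
    using NN.integral_fst'[OF int_D] by simp
  also have "\<dots> = (\<integral>w. (U w * S w + S w) / 2 \<partial>N)"
  proof (rule integral_cong_AE)
    \<comment> \<open>Only almost everywhere: the formula \<open>(u + 1) / 2\<close> is available
      for \<open>\<bar>u\<bar> \<le> 1\<close>.\<close>
    show "AE w in N. (\<integral>w'. ?D w w' \<partial>N) = (U w * S w + S w) / 2"
      using U_bd
    proof eventually_elim
      case (elim w)
      have "(\<integral>w'. ?D w w' \<partial>N) = (\<integral>w'. indicator {w' \<in> space N. U w' < U w} w' \<partial>N) * S w"
        by (subst integral_mult_left_zero[symmetric])
           (auto intro!: Bochner_Integration.integral_cong simp: indicator_def)
      then show ?case
        using prob_less[OF elim] by (simp add: field_simps)
    qed
  qed simp_all
  also have "\<dots> = ((\<integral>w. U w * S w \<partial>N) + (\<integral>w. S w \<partial>N)) / 2"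
    using int_US int_S by simp
  finally have D: "(\<integral>(w, w'). ?D w w' \<partial>(N \<Otimes>\<^sub>M N)) =
      ((\<integral>w. U w * S w \<partial>N) + (\<integral>w. S w \<partial>N)) / 2" .
  moreover have "(\<integral>(w, w'). ?D w' w \<partial>(N \<Otimes>\<^sub>M N)) = (\<integral>(w, w'). ?D w w' \<partial>(N \<Otimes>\<^sub>M N))"
    using NN.integral_product_swap[of "\<lambda>(w, w'). ?D w w'"] by simp
  moreover have "(\<integral>(w, w'). ?D w w' + ?D w' w \<partial>(N \<Otimes>\<^sub>M N)) =
      (\<integral>(w, w'). ?D w w' \<partial>(N \<Otimes>\<^sub>M N)) + (\<integral>(w, w'). ?D w' w \<partial>(N \<Otimes>\<^sub>M N))"
    using Bochner_Integration.integral_add[OF int_D int_D'] by (simp add: split_beta')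
  ultimately show "(\<integral>w. U w * S w \<partial>N) + (\<integral>w. S w \<partial>N) = (\<integral>(w, w'). ?D w w' + ?D w' w \<partial>(N \<Otimes>\<^sub>M N))"
    by simp
  show "integrable (N \<Otimes>\<^sub>M N) (\<lambda>(w, w'). ?D w w' + ?D w' w)"
    using Bochner_Integration.integrable_add[OF int_D int_D'] by (simp add: split_beta')
qed

text \<open>Taking the law as argument lets the same number be computed on couplings, on the space
  enlarged by noise and on the space of the given random vectors.\<close>

definition mean_max :: "real measure \<Rightarrow> real" where
  "mean_max L = (\<integral>(s, s'). max s s' \<partial>(L \<Otimes>\<^sub>M L))"

lemma mean_max_distr:
  assumes "prob_space N" and [measurable]: "S \<in> borel_measurable N"
  shows "mean_max (distr N borel S) = (\<integral>(w, w'). max (S w) (S w') \<partial>(N \<Otimes>\<^sub>M N))"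
proof -
  interpret prob_space N by fact
  interpret L: real_distribution "distr N borel S" by simp
  have "distr N borel S \<Otimes>\<^sub>M distr N borel S =
      distr (N \<Otimes>\<^sub>M N) (borel \<Otimes>\<^sub>M borel) (\<lambda>(w, w'). (S w, S w'))"
    by (rule pair_measure_distr) (auto intro: L.sigma_finite_measure_axioms)
  then show ?thesis
    unfolding mean_max_def by (simp add: integral_distr split_beta')
qed

lemma integrable_max_copies:
  fixes S :: "'a \<Rightarrow> real"
  assumes "prob_space N" and [measurable]: "S \<in> borel_measurable N"
    and S: "AE w in N. \<bar>S w\<bar> \<le> B"
  shows "integrable (N \<Otimes>\<^sub>M N) (\<lambda>(w, w'). max (S w) (S w'))"
proof -
  interpret prob_space N by fact
  interpret NN: pair_prob_space N N ..
  have AE1: "AE z in N \<Otimes>\<^sub>M N. \<bar>S (fst z)\<bar> \<le> B"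
    using S by (intro NN.AE_pair_measure) auto
  have AE2: "AE z in N \<Otimes>\<^sub>M N. \<bar>S (snd z)\<bar> \<le> B"
    using S by (intro NN.AE_pair_measure) auto
  have "AE z in N \<Otimes>\<^sub>M N. norm (case z of (w, w') \<Rightarrow> max (S w) (S w')) \<le> B"
    using AE1 AE2 by eventually_elim (auto simp: split_beta)
  then show ?thesis
    by (rule NN.integrable_const_bound) simp
qed

text \<open>Without atoms the second copy misses each fixed value almost surely; Fubini joins these
  sections. This discards the ties on which both indicators in the rank identity vanish.\<close>

lemma AE_copies_neq:
  fixes U :: "'a \<Rightarrow> real"
  assumes "prob_space N" and [measurable]: "U \<in> borel_measurable N"
    and U: "\<And>x. measure (distr N borel U) {x} = 0"
  shows "AE z in N \<Otimes>\<^sub>M N. U (fst z) \<noteq> U (snd z)"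
proof -
  interpret prob_space N by fact
  interpret NN: pair_prob_space N N ..
  have "AE w' in N. u \<noteq> U w'" for u
  proof -
    have "measure (distr N borel U) {u} = prob {w' \<in> space N. U w' = u}"
      by (subst measure_distr) (auto intro!: arg_cong[where f = prob])
    then have "prob {w' \<in> space N. U w' = u} = 0"
      using U by simp
    moreover have "{w' \<in> space N. U w' = u} \<in> events"
      by measurable
    ultimately have "AE w' in N. U w' \<noteq> u"
      using prob_eq_0[of "{w' \<in> space N. U w' = u}"] by (auto elim!: eventually_mono)
    then show ?thesis by eventually_elim auto
  qed
  then show ?thesis
    by (intro NN.AE_pair_measure) auto
qed

text \<open>Off the ties exactly one of the two indicators equals 1, so the integrand of the rank
  identity is one of the two copies of \<open>S\<close>, hence at most their maximum.\<close>

lemma integral_uniform_times_le: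
  assumes N: "prob_space N" and [measurable]: "U \<in> borel_measurable N" "S \<in> borel_measurable N"
    and U: "distr N borel U = uniform_pm1" and S: "AE w in N. \<bar>S w\<bar> \<le> B"
    and S0: "(\<integral>w. S w \<partial>N) = 0"
  shows "(\<integral>w. U w * S w \<partial>N) \<le> mean_max (distr N borel S)"
proof -
  have "AE z in N \<Otimes>\<^sub>M N. U (fst z) \<noteq> U (snd z)"
    by (intro AE_copies_neq N) (auto simp: U measure_uniform_pm1_singleton)
  then have "AE z in N \<Otimes>\<^sub>M N. (case z of (w, w') \<Rightarrow>
      of_bool (U w' < U w) * S w + of_bool (U w < U w') * S w') \<le>
      (case z of (w, w') \<Rightarrow> max (S w) (S w'))"
    by eventually_elim (auto simp: split_beta of_bool_def)
  from integral_mono_AE[OF integral_uniform_times(2)[OF N _ _ U S]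
      integrable_max_copies[OF N _ S] this]
  show ?thesis
    using integral_uniform_times(1)[OF N _ _ U S] S0 mean_max_distr[OF N, of S] by simp
qed

text \<open>Here \<open>U\<close> selects the copy with the larger \<open>R\<close>, up to equality
  of the \<open>R\<close> values. Since \<open>R\<close> and \<open>S\<close> differ by at most
  \<open>e\<close> at either copy, the selected value of \<open>S\<close> falls short of the maximum
  by at most \<open>2 * e\<close>.\<close>

lemma integral_uniform_times_ge:
  assumes N: "prob_space N" and [measurable]: "U \<in> borel_measurable N" "S \<in> borel_measurable N"
    and U: "distr N borel U = uniform_pm1" and S: "AE w in N. \<bar>S w\<bar> \<le> B"
    and S0: "(\<integral>w. S w \<partial>N) = 0"
    and R: "AE w in N. \<bar>R w - S w\<bar> \<le> e" and UR: "\<And>w w'. U w < U w' \<Longrightarrow> R w \<le> R w'"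
    and [measurable]: "R \<in> borel_measurable N"
  shows "mean_max (distr N borel S) - 2 * e \<le> (\<integral>w. U w * S w \<partial>N)"
proof -
  interpret prob_space N by fact
  interpret NN: pair_prob_space N N ..
  have "AE z in N \<Otimes>\<^sub>M N. U (fst z) \<noteq> U (snd z)"
    by (intro AE_copies_neq N) (auto simp: U measure_uniform_pm1_singleton)
  moreover have "AE z in N \<Otimes>\<^sub>M N. \<bar>R (fst z) - S (fst z)\<bar> \<le> e"
    using R by (intro NN.AE_pair_measure) auto
  moreover have "AE z in N \<Otimes>\<^sub>M N. \<bar>R (snd z) - S (snd z)\<bar> \<le> e"
    using R by (intro NN.AE_pair_measure) auto
  ultimately have "AE z in N \<Otimes>\<^sub>M N. (case z of (w, w') \<Rightarrow> max (S w) (S w')) \<le>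
     (case z of (w, w') \<Rightarrow> of_bool (U w' < U w) * S w + of_bool (U w < U w') * S w') + 2 * e"
  proof eventually_elim
    case (elim z)
    then show ?case
      using UR[of "fst z" "snd z"] UR[of "snd z" "fst z"]
      by (cases "U (fst z) < U (snd z)") (auto simp: split_beta)
  qed
  moreover note int = integral_uniform_times(2)[OF N _ _ U S] integrable_max_copies[OF N _ S]
  ultimately have "(\<integral>(w, w'). max (S w) (S w') \<partial>(N \<Otimes>\<^sub>M N)) \<le>
     (\<integral>z. (case z of (w, w') \<Rightarrow> of_bool (U w' < U w) * S w + of_bool (U w < U w') * S w') + 2 * e
       \<partial>(N \<Otimes>\<^sub>M N))"
    by (intro integral_mono_AE) auto
  also have "\<dots> = (\<integral>w. U w * S w \<partial>N) + 2 * e"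
    using integral_uniform_times(1)[OF N _ _ U S] S0 int NN.prob_space by simp
  finally show ?thesis
    using mean_max_distr[OF N, of S] by simp
qed

subsection \<open>The transport cost\<close>

text \<open>The squared norm expands to \<open>2 U^2 + X^2 + Y^2 - 2 U (X + Y)\<close>, and the
  squares contribute 2/3 + 1/3 + 1/3. The second claim, nonnegativity of the cost, ensures that
  \<open>ennreal\<close> truncates nothing.\<close>

lemma nn_integral_diagonal_cost:
  fixes U X Y :: "'a \<Rightarrow> real"
  assumes N: "prob_space N"
    and [measurable]: "U \<in> borel_measurable N" "X \<in> borel_measurable N" "Y \<in> borel_measurable N"
    and U: "distr N borel U = uniform_pm1" and X: "distr N borel X = uniform_pm1"
    and Y: "distr N borel Y = uniform_pm1"
  shows "(\<integral>\<^sup>+ w. ennreal ((norm ((U w, U w) - (X w, Y w)))\<^sup>2) \<partial>N) =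
      ennreal (4 / 3 - 2 * (\<integral>w. U w * (X w + Y w) \<partial>N))"
    and "2 * (\<integral>w. U w * (X w + Y w) \<partial>N) \<le> 4 / 3"
proof -
  interpret prob_space N by fact
  have bound: "AE w in N. \<bar>V w * V' w\<bar> \<le> 1"
    if "V \<in> {U, X, Y}" "V' \<in> {U, X, Y}" for V V'
  proof -
    have "AE w in N. \<bar>V w\<bar> \<le> 1" "AE w in N. \<bar>V' w\<bar> \<le> 1"
      using that uniform_pm1_rv(1)[OF N] U X Y by auto
    then show ?thesis
      by eventually_elim (simp add: abs_mult mult_le_one)
  qed
  have int: "integrable N (\<lambda>w. V w * V' w)" if "V \<in> {U, X, Y}" "V' \<in> {U, X, Y}" for V V'
    using bound[OF that] that by (intro integrable_const_bound[of _ 1]) auto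
  note ints = int[of U U] int[of X X] int[of Y Y] int[of U X] int[of U Y]
  have sq: "(\<integral>w. V w * V w \<partial>N) = 1 / 3" if "V \<in> {U, X, Y}" for V
    using that uniform_pm1_rv(3)[OF N] U X Y by (auto simp: power2_eq_square)
  define c where "c w = (norm ((U w, U w) - (X w, Y w)))\<^sup>2" for w
  have c: "c w = 2 * (U w * U w) + X w * X w + Y w * Y w - 2 * (U w * X w) - 2 * (U w * Y w)" for w
    unfolding c_def by (simp add: norm_Pair) (simp add: algebra_simps power2_eq_square)
  have int_c: "integrable N c"
    unfolding c using ints by simp
  have "(\<integral>w. c w \<partial>N) = 4 / 3 - 2 * (\<integral>w. U w * (X w + Y w) \<partial>N)"
    unfolding c distrib_left using ints sq[of U] sq[of X] sq[of Y] by simp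
  moreover have "(\<integral>\<^sup>+ w. ennreal (c w) \<partial>N) = ennreal (\<integral>w. c w \<partial>N)"
    by (rule nn_integral_eq_integral[OF int_c]) (simp add: c_def)
  moreover have "0 \<le> (\<integral>w. c w \<partial>N)"
    by (rule Bochner_Integration.integral_nonneg) (simp add: c_def)
  ultimately show "(\<integral>\<^sup>+ w. ennreal ((norm ((U w, U w) - (X w, Y w)))\<^sup>2) \<partial>N) =
      ennreal (4 / 3 - 2 * (\<integral>w. U w * (X w + Y w) \<partial>N))"
    and "2 * (\<integral>w. U w * (X w + Y w) \<partial>N) \<le> 4 / 3"
    unfolding c_def by simp_all
qed

lemma borel_measurable_fst_snd [measurable]:
  "fst \<in> borel_measurable (borel :: ('a::topological_space \<times> 'b::topological_space) measure)"
  "snd \<in> borel_measurable (borel :: ('a::topological_space \<times> 'b::topological_space) measure)"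
  by (auto intro!: borel_measurable_continuous_onI continuous_intros)

text \<open>The coupling itself serves as the probability space. Its first point lies almost surely
  on the diagonal, so the single coordinate \<open>u\<close> determines the cost and the bound by
  the mean maximum applies to \<open>u\<close> and \<open>s\<close>.\<close>

lemma coupling_id_permuton:
  assumes P: "permuton P" and \<pi>: "\<pi> \<in> couplings id_permuton P"
  defines "u \<equiv> \<lambda>z. fst (fst z)" and "s \<equiv> \<lambda>z. fst (snd z) + snd (snd z)"
  shows "(\<integral>\<^sup>+ z. ennreal ((norm (fst z - snd z))\<^sup>2) \<partial>\<pi>) =
      ennreal (4 / 3 - 2 * (\<integral>z. u z * s z \<partial>\<pi>))"
    and "2 * (\<integral>z. u z * s z \<partial>\<pi>) \<le> 4 / 3"
    and "(\<integral>z. u z * s z \<partial>\<pi>) \<le> mean_max (distr P borel (\<lambda>z. fst z + snd z))"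
proof -
  from \<pi> have \<pi>_prob: "prob_space \<pi>" and [measurable_cong]: "sets \<pi> = sets borel"
    and \<pi>1: "distr \<pi> borel fst = id_permuton" and \<pi>2: "distr \<pi> borel snd = P"
    by (auto simp: couplings_def)
  interpret prob_space \<pi> by fact
  have [measurable]: "u \<in> borel_measurable \<pi>" "s \<in> borel_measurable \<pi>"
    unfolding u_def s_def by measurable
  have X: "distr \<pi> borel (\<lambda>z. fst (snd z)) = uniform_pm1"
    and Y: "distr \<pi> borel (\<lambda>z. snd (snd z)) = uniform_pm1"
    and U: "distr \<pi> borel u = uniform_pm1"
    and S: "distr \<pi> borel s = distr P borel (\<lambda>z. fst z + snd z)"
    using P permuton_id_permuton unfolding permuton_def u_def s_def \<pi>1[symmetric] \<pi>2[symmetric]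
    by (simp_all add: distr_distr comp_def)
  have "AE z in distr \<pi> borel fst. fst z = snd z"
    unfolding \<pi>1 id_permuton_def by (subst AE_distr_iff) auto
  then have diag: "AE z in \<pi>. fst (fst z) = snd (fst z)"
    by (rule AE_distrD[rotated]) measurable
  have "(\<integral>\<^sup>+ z. ennreal ((norm (fst z - snd z))\<^sup>2) \<partial>\<pi>) =
      (\<integral>\<^sup>+ z. ennreal ((norm ((u z, u z) - (fst (snd z), snd (snd z))))\<^sup>2) \<partial>\<pi>)"
    by (rule nn_integral_cong_AE)
       (use diag in eventually_elim, simp add: u_def norm_prod_def)
  then show "(\<integral>\<^sup>+ z. ennreal ((norm (fst z - snd z))\<^sup>2) \<partial>\<pi>) =
      ennreal (4 / 3 - 2 * (\<integral>z. u z * s z \<partial>\<pi>))"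
    using nn_integral_diagonal_cost(1)[OF \<pi>_prob _ _ _ U X Y] by (simp add: s_def)
  show "2 * (\<integral>z. u z * s z \<partial>\<pi>) \<le> 4 / 3"
    using nn_integral_diagonal_cost(2)[OF \<pi>_prob _ _ _ U X Y] by (simp add: s_def)
  note XY = uniform_pm1_rv[OF \<pi>_prob _ X] uniform_pm1_rv[OF \<pi>_prob _ Y]
  have "AE z in \<pi>. \<bar>fst (snd z)\<bar> \<le> 1" "AE z in \<pi>. \<bar>snd (snd z)\<bar> \<le> 1"
    using XY by auto
  then have S2: "AE z in \<pi>. \<bar>s z\<bar> \<le> 2"
    by eventually_elim (simp add: s_def)
  have "integrable \<pi> (\<lambda>z. fst (snd z))" "integrable \<pi> (\<lambda>z. snd (snd z))"
    using XY by (auto intro!: integrable_const_bound[of _ 1])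
  then have "(\<integral>z. s z \<partial>\<pi>) = 0"
    using XY by (simp add: s_def)
  from integral_uniform_times_le[OF \<pi>_prob _ _ U S2 this]
  show "(\<integral>z. u z * s z \<partial>\<pi>) \<le> mean_max (distr P borel (\<lambda>z. fst z + snd z))"
    by (simp add: S)
qed

subsection \<open>Almost optimal couplings\<close>

text \<open>The sum \<open>X + Y\<close> may have atoms. Adding a small independent uniform noise makes its
  distribution function continuous, so that the rank of the perturbed sum is uniform and
  comonotone with \<open>X + Y\<close> up to the size of the noise.\<close>

lemma ex_almost_optimal_coupling:
  assumes P: "permuton P" and e: "0 < e"
  shows "\<exists>\<pi>\<in>couplings id_permuton P. mean_max (distr P borel (\<lambda>z. fst z + snd z)) - 2 * e \<le>
    (\<integral>z. fst (fst z) * (fst (snd z) + snd (snd z)) \<partial>\<pi>)"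
proof -
  from P have P_prob: "prob_space P" and sets_P [measurable_cong]: "sets P = sets borel"
    and P1: "distr P borel fst = uniform_pm1" and P2: "distr P borel snd = uniform_pm1"
    by (auto simp: permuton_def)
  interpret P: prob_space P by fact
  interpret uniform: prob_space uniform_pm1 by (rule prob_space_uniform_pm1)
  interpret N: pair_prob_space P uniform_pm1 ..
  \<comment> \<open>The first component of \<open>N\<close> is a point with law \<open>P\<close>,
    the second is the independent noise.\<close>
  define N where "N = P \<Otimes>\<^sub>M uniform_pm1"
  have N_prob: "prob_space N" unfolding N_def by (rule N.prob_space_axioms)
  interpret NN: prob_space N by fact
  have [measurable_cong]: "sets N = sets (borel \<Otimes>\<^sub>M borel)"
    unfolding N_def by (intro sets_pair_measure_cong) (simp_all add: sets_P)
  have N_fst: "distr N borel fst = P"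
  proof -
    have "distr N borel fst = distr N P fst"
      by (rule distr_cong) (simp_all add: sets_P)
    then show ?thesis
      by (simp add: N_def uniform.distr_pair_fst)
  qed
  define s :: "(real \<times> real) \<times> real \<Rightarrow> real" where "s w = fst (fst w) + snd (fst w)" for w
  define R where "R w = s w + e * snd w" for w
  have [measurable]: "s \<in> borel_measurable N" "R \<in> borel_measurable N"
    unfolding R_def s_def by measurable
  define G where "G = cdf (distr N borel R)"
  define u where "u w = 2 * G (R w) - 1" for w

  have X: "distr N borel (\<lambda>w. fst (fst w)) = uniform_pm1"
    and Y: "distr N borel (\<lambda>w. snd (fst w)) = uniform_pm1"
    and S: "distr N borel s = distr P borel (\<lambda>z. fst z + snd z)"
    using P1 P2 unfolding s_def N_fst[symmetric] by (simp_all add: distr_distr comp_def)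

  interpret L: real_distribution "distr N borel R" by simp
  \<comment> \<open>For a fixed point \<open>z\<close> only the noise value
    \<open>(x - s (z, 0)) / e\<close> yields \<open>R = x\<close>, and a single value is null. The 0
    is a placeholder, as \<open>s\<close> ignores the noise. By Fubini the law of \<open>R\<close>
    has no atoms.\<close>
  have cont: "isCont (cdf (distr N borel R)) x" for x
  proof -
    have ne: "AE t in uniform_pm1. t \<noteq> c" for c
      using uniform.prob_eq_0[of "{c}"] measure_uniform_pm1_singleton[of c] by auto
    have "AE z in P. AE t in uniform_pm1. R (z, t) \<noteq> x"
    proof (rule AE_I2)
      fix z
      show "AE t in uniform_pm1. R (z, t) \<noteq> x"
        using ne[of "(x - s (z, 0)) / e"]
        by eventually_elim (use e in \<open>auto simp: R_def s_def field_simps\<close>)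
    qed
    moreover have "{w \<in> space N. R w \<noteq> x} \<in> sets N"
      by measurable
    ultimately have "AE w in N. R w \<noteq> x"
      unfolding N_def by (intro N.AE_pair_measure)
    then have "AE r in distr N borel R. r \<notin> {x}"
      by (subst AE_distr_iff) auto
    then show ?thesis
      by (subst L.isCont_cdf, subst L.prob_eq_0) auto
  qed
  have G_mono: "G x \<le> G y" if "x \<le> y" for x y
    unfolding G_def using that by (rule L.cdf_nondecreasing)
  have [measurable]: "G \<in> borel_measurable borel"
    using G_mono by (intro borel_measurable_mono monoI)
  have u_borel [measurable]: "u \<in> borel_measurable N"
    unfolding u_def by measurable
  have U: "distr N borel u = uniform_pm1"
    using distr_cdf_uniform[OF N_prob _ cont] unfolding u_def G_def by simp

  note XY = uniform_pm1_rv[OF N_prob _ X] uniform_pm1_rv[OF N_prob _ Y]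
  have "AE w in N. \<bar>fst (fst w)\<bar> \<le> 1" "AE w in N. \<bar>snd (fst w)\<bar> \<le> 1"
    using XY by auto
  then have S2: "AE w in N. \<bar>s w\<bar> \<le> 2"
    by eventually_elim (simp add: s_def)
  have "integrable N (\<lambda>w. fst (fst w))" "integrable N (\<lambda>w. snd (fst w))"
    using XY by (auto intro!: NN.integrable_const_bound[of _ 1])
  then have S0: "(\<integral>w. s w \<partial>N) = 0"
    using XY by (simp add: s_def)
  have noise: "AE w in N. \<bar>R w - s w\<bar> \<le> e"
  proof -
    have "AE w in N. \<bar>snd w\<bar> \<le> 1"
    proof -
      have "{w \<in> space N. \<bar>snd w\<bar> \<le> 1} \<in> sets N"
        by measurable
      then show ?thesis
        unfolding N_def using AE_uniform_pm1 by (intro N.AE_pair_measure) auto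
    qed
    then show ?thesis
      by eventually_elim (use e in \<open>simp add: R_def abs_mult\<close>)
  qed
  have near: "mean_max (distr N borel s) - 2 * e \<le> (\<integral>w. u w * s w \<partial>N)"
  proof (rule integral_uniform_times_ge[OF N_prob _ _ U S2 S0 noise])
    \<comment> \<open>Contraposition: \<open>R w' < R w\<close> would give
      \<open>u w' \<le> u w\<close> by monotonicity of \<open>G\<close>.\<close>
    show "R w \<le> R w'" if "u w < u w'" for w w'
      using that G_mono[of "R w'" "R w"] unfolding u_def by linarith
  qed (use e in simp_all)

  \<comment> \<open>The point with law \<open>P\<close> is matched with the diagonal point at the
    rank of its perturbed sum.\<close>
  define \<pi> where "\<pi> = distr N borel (\<lambda>w. ((u w, u w), fst w))"
  have [measurable]: "(\<lambda>w. ((u w, u w), fst w)) \<in> borel_measurable N"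
    by measurable
  have "distr \<pi> borel fst = distr N borel (\<lambda>w. (u w, u w))"
    unfolding \<pi>_def by (simp add: distr_distr comp_def)
  also have "\<dots> = id_permuton"
    unfolding id_permuton_def U[symmetric] by (simp add: distr_distr comp_def)
  finally have \<pi>: "\<pi> \<in> couplings id_permuton P"
    using N_fst NN.prob_space_distr[of "\<lambda>w. ((u w, u w), fst w)" borel]
    unfolding couplings_def \<pi>_def by (simp add: distr_distr comp_def)
  have "(\<integral>z. fst (fst z) * (fst (snd z) + snd (snd z)) \<partial>\<pi>) = (\<integral>w. u w * s w \<partial>N)"
    unfolding \<pi>_def by (subst integral_distr) (auto simp: s_def)
  then show ?thesis
    using near by (intro bexI[OF _ \<pi>]) (simp add: S)
qed

section \<open>The value of the infimum and its expression by random vectors\<close>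

lemma wasserstein2_id_permuton:
  assumes P: "permuton P"
  shows "(wasserstein2 id_permuton P)\<^sup>2 = 4 / 3 - 2 * mean_max (distr P borel (\<lambda>z. fst z + snd z))"
proof -
  define b where "b \<pi> = (\<integral>z. fst (fst z) * (fst (snd z) + snd (snd z)) \<partial>\<pi>)"
    for \<pi> :: "((real \<times> real) \<times> (real \<times> real)) measure"
  define m where "m = mean_max (distr P borel (\<lambda>z. fst z + snd z))"
  note coupling = coupling_id_permuton[OF P, folded b_def m_def]
  have almost: "\<exists>\<pi>\<in>couplings id_permuton P. m - e \<le> b \<pi>" if "0 < e" for e
    using ex_almost_optimal_coupling[OF P, of "e / 2"] that by (simp add: b_def m_def)
  \<comment> \<open>Almost optimal couplings have nonnegative cost, which makes the limiting value
    nonnegative. Hence \<open>ennreal\<close>, \<open>enn2real\<close> and the square root followed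
    by squaring all return it unchanged.\<close>
  have m: "2 * m \<le> 4 / 3"
  proof (rule field_le_epsilon)
    fix e :: real assume "0 < e"
    then obtain \<pi> where "\<pi> \<in> couplings id_permuton P" "m - e / 2 \<le> b \<pi>"
      using almost[of "e / 2"] by auto
    then show "2 * m \<le> 4 / 3 + e"
      using coupling(2)[of \<pi>] unfolding b_def by linarith
  qed
  have "(INF \<pi>\<in>couplings id_permuton P. \<integral>\<^sup>+ z. ennreal ((norm (fst z - snd z))\<^sup>2) \<partial>\<pi>) =
      ennreal (4 / 3 - 2 * m)" (is "?I = _")
  proof (rule antisym)
    show "ennreal (4 / 3 - 2 * m) \<le> ?I"
      using coupling(1,3) by (auto intro!: INF_greatest ennreal_leI simp: b_def)
    show "?I \<le> ennreal (4 / 3 - 2 * m)"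
    \<comment> \<open>The cost contains \<open>b \<pi>\<close> with factor 2, so a coupling within
      \<open>e / 2\<close> of \<open>m\<close> costs at most \<open>e\<close> more than the claimed
      infimum.\<close>
    proof (rule ennreal_le_epsilon)
      fix e :: real assume e: "0 < e"
      then obtain \<pi> where \<pi>: "\<pi> \<in> couplings id_permuton P" "m - e / 2 \<le> b \<pi>"
        using almost[of "e / 2"] by auto
      then have "?I \<le> ennreal (4 / 3 - 2 * b \<pi>)"
        using coupling(1)[of \<pi>] by (intro INF_lower2[of \<pi>]) (auto simp: b_def)
      also have "\<dots> \<le> ennreal (4 / 3 - 2 * m + e)"
        using \<pi> by (intro ennreal_leI) linarith
      also have "\<dots> = ennreal (4 / 3 - 2 * m) + ennreal e"
        using m e by (intro ennreal_plus) auto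
      finally show "?I \<le> ennreal (4 / 3 - 2 * m) + ennreal e" .
    qed
  qed
  then show ?thesis
    using m unfolding wasserstein2_def m_def by simp
qed

theorem theorem6:
  fixes P :: "(real \<times> real) measure"
    and M :: "'a measure"
    and X Y X' Y' :: "'a \<Rightarrow> real"
  assumes "permuton P"
    and "prob_space M"
    and "X \<in> borel_measurable M" and "Y \<in> borel_measurable M"
    and "X' \<in> borel_measurable M" and "Y' \<in> borel_measurable M"
    and "distr M borel (\<lambda>\<omega>. (X \<omega>, Y \<omega>)) = P"
    and "distr M borel (\<lambda>\<omega>. (X' \<omega>, Y' \<omega>)) = P"
    and "prob_space.indep_var M borel (\<lambda>\<omega>. (X \<omega>, Y \<omega>)) borel (\<lambda>\<omega>. (X' \<omega>, Y' \<omega>))"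
  shows "(wasserstein2 id_permuton P)\<^sup>2 =
    4 / 3 - 2 * prob_space.expectation M (\<lambda>\<omega>. max (X \<omega> + Y \<omega>) (X' \<omega> + Y' \<omega>))"
proof -
  interpret prob_space M by fact
  note [measurable] = assms(3-6)
  from assms(1) have P_prob: "prob_space P" and [measurable_cong]: "sets P = sets borel"
    by (auto simp: permuton_def)
  \<comment> \<open>Independence enters here: it makes the joint law of the two vectors the product
    measure over which \<open>mean_max\<close> integrates.\<close>
  have joint: "P \<Otimes>\<^sub>M P = distr M (borel \<Otimes>\<^sub>M borel) (\<lambda>\<omega>. ((X \<omega>, Y \<omega>), (X' \<omega>, Y' \<omega>)))"
    using assms(9) unfolding indep_var_distribution_eq assms(7,8) by simp
  have "mean_max (distr P borel (\<lambda>z. fst z + snd z)) =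
      (\<integral>(z, z'). max (fst z + snd z) (fst z' + snd z') \<partial>(P \<Otimes>\<^sub>M P))"
    by (rule mean_max_distr[OF P_prob]) measurable
  also have "\<dots> = expectation (\<lambda>\<omega>. max (X \<omega> + Y \<omega>) (X' \<omega> + Y' \<omega>))"
    unfolding joint by (subst integral_distr) (auto simp: split_beta')
  finally show ?thesis
    using wasserstein2_id_permuton[OF assms(1)] by simp
qed

end
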